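(* Let $\{\Gamma_\ell\mid \ell\in\mathbb{N}\cup\{0\}\}$ and $\{\Upsilon_j\mid j\in\mathbb{N}\}$ be sequences of nonnegative real numbers with $\sum_{j=1}^\infty \Upsilon_j<\infty$. For every finite subset $v\subseteq\mathbb{N}$ put $\gamma_v=\Gamma_{|v|}\prod_{j\in v}\Upsilon_j$, and for real $m>0$ let $S_{\boldsymbol{\gamma}}(m)=\sum_{v\subseteq\mathbb{N}}\gamma_v m^{|v|}$. Then for every $m>0$, $$S_{\boldsymbol{\gamma}}(m)\leq \Gamma_0+\sum_{\ell=1}^\infty \exp(\ell+1)\, \Gamma_\ell\, m^\ell \prod_{J=1}^\ell \max\left(\Upsilon_J,\frac{1}{J}\sum_{j=J+1}^\infty \Upsilon_j\right).$$
   Context: $\mathbb{N}=\{1,2,3,\dots\}$. Sums over $v\subseteq\mathbb{N}$ run over all finite subsets of $\mathbb{N}$, including the empty set; empty products equal $1$ (so $\gamma_\emptyset=\Gamma_0$). All sums have nonnegative terms and take values in $[0,\infty]$. *)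

theory Defs
  imports "HOL-Analysis.Infinite_Sum" "HOL-Library.Extended_Nonnegative_Real"
begin

(* The index set is the positive integers {1..}; the value \<Upsilon> 0 is never used. *)

definition pod_weight :: "(nat \<Rightarrow> real) \<Rightarrow> (nat \<Rightarrow> real) \<Rightarrow> nat set \<Rightarrow> real" where
  "pod_weight \<Gamma> \<Upsilon> v = \<Gamma> (card v) * (\<Prod>j\<in>v. \<Upsilon> j)"

(* The sum is taken in ennreal, so it always exists and is \<infinity> when divergent. For
   nonnegative weights the argument of ennreal is nonnegative, so nothing is truncated. *)
definition weight_sum :: "(nat set \<Rightarrow> real) \<Rightarrow> real \<Rightarrow> ennreal" where
  "weight_sum \<gamma> m =
     (\<Sum>\<^sub>\<infinity>v\<in>{v. finite v \<and> v \<subseteq> {1..}}. ennreal (\<gamma> v * m ^ card v))"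

end

theory Submission imports Defs begin

text \<open>
  Only the sets of a fixed cardinality \<open>l\<close> matter: their products add up to the elementary symmetric
  sum \<open>e\<close> of degree \<open>l\<close>. With \<open>T J\<close> the tail sum over \<open>j > J\<close>, expanding a product gives, for every
  \<open>t > 0\<close>, the bound \<open>t ^ l * e \<le> (\<Prod>J=1..l. 1 + t * \<Upsilon> J) * exp (t * T l)\<close>. Take \<open>t * T l = (l + 1) / 2\<close>.
  Replacing the factor \<open>1 + t * \<Upsilon> J\<close> by \<open>t * max (\<Upsilon> J) (T J / J)\<close> loses a factor whose logarithm is at
  most the increment from \<open>J - 1\<close> to \<open>J\<close> of the potential \<open>2 * (J + 1)\<^sup>2 / (6 * t * T J + J + 1)\<close>.
  The increments telescope to at most \<open>(l + 1) / 2\<close>, so the total loss is \<open>exp (l + 1)\<close>.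
\<close>

section \<open>Rational bounds in one variable\<close>

text \<open>The right side is the [2/1] Pade approximant of \<open>ln (1 + w)\<close> at 0. The
  difference vanishes at 0 and has derivative
  \<open>4 * x ^ 3 / ((6 + 4 * x)\<^sup>2 * (1 + x))\<close>, which is nonnegative.\<close>

lemma ln_one_plus_le_pade:
  fixes w :: real
  assumes "w \<ge> 0"
  shows "ln (1 + w) \<le> w * (6 + w) / (6 + 4 * w)"
proof -
  let ?g = "\<lambda>w::real. w * (6 + w) / (6 + 4 * w) - ln (1 + w)"
  have "?g 0 \<le> ?g w"
  proof (rule DERIV_nonneg_imp_nondecreasing[OF assms])
    fix x :: real assume x: "0 \<le> x" "x \<le> w"
    have "(?g has_real_derivative
        ((6 + 2 * x) * (6 + 4 * x) - x * (6 + x) * 4) / ((6 + 4 * x) * (6 + 4 * x)) - 1 / (1 + x)) (at x)"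
      using x by (auto intro!: derivative_eq_intros simp: algebra_simps)
    moreover have "((6 + 2 * x) * (6 + 4 * x) - x * (6 + x) * 4) / ((6 + 4 * x) * (6 + 4 * x)) - 1 / (1 + x)
        = 4 * x ^ 3 / ((6 + 4 * x) * (6 + 4 * x) * (1 + x))"
      using x by (simp add: divide_simps add_nonneg_eq_0_iff) (simp add: algebra_simps power3_eq_cube)
    ultimately show "\<exists>y. (?g has_real_derivative y) (at x) \<and> y \<ge> 0"
      using x by (metis (no_types, lifting) add_nonneg_nonneg divide_nonneg_nonneg mult_nonneg_nonneg
          zero_le_numeral zero_le_one zero_le_power)
  qed
  then show ?thesis by simp
qed

lemma inverse_affine_convex:
  fixes a b \<theta> :: real
  assumes "a > 0" "b \<ge> 0" "0 \<le> \<theta>" "\<theta> \<le> 1"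
  shows "1 / (a + \<theta> * b) \<le> (1 - \<theta>) * (1 / a) + \<theta> * (1 / (a + b))"
proof -
  have "a + \<theta> * b > 0" "a + b > 0" using assms by (auto intro: add_pos_nonneg)
  \<comment> \<open>This is exactly the difference of the two sides after clearing
    denominators.\<close>
  moreover have "\<theta> * (1 - \<theta>) * b\<^sup>2 \<ge> 0" using assms by simp
  ultimately show ?thesis using assms(1)
    by (simp add: divide_simps) (simp add: algebra_simps power2_eq_square)
qed

section \<open>Increments of the potential\<close>

text \<open>
  The form \<open>A * (J + 1)\<^sup>2 / (s + B * (J + 1))\<close> is a rational substitute for the optimal loss, which
  involves an arctangent. Large \<open>s\<close> forces \<open>A \<ge> 1 / 3\<close>; with \<open>A = 1 / 3\<close>, the value \<open>B = 1 / 6\<close> makes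
  \<open>s + potential J s\<close> equal to \<open>J + 1\<close> at \<open>s = (J + 1) / 2\<close>.
\<close>

definition potential :: "real \<Rightarrow> real \<Rightarrow> real" where
  "potential J s = 2 * (J + 1)\<^sup>2 / (6 * s + J + 1)"

text \<open>The case \<open>x = s / J\<close> of the one-step inequality, where both arguments of
  the maximum agree. The Pade bound reduces it to a polynomial inequality.\<close>

lemma ln_ratio_le_potential_diff_max:
  fixes J s :: real
  assumes "J \<ge> 1" "s \<ge> (J + 1) / 2"
  shows "ln (1 + J / s) \<le> potential J s - potential (J - 1) (s + s / J)"
proof -
  \<comment> \<open>The constraints on \<open>J\<close> and \<open>s\<close> become nonnegativity of
    \<open>k\<close> and \<open>u\<close>. In these variables the cross-multiplied difference has
    only positive coefficients.\<close>
  define k u where "k = J - 1" and "u = 2 * s - J - 1"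
  have ku: "k \<ge> 0" "u \<ge> 0" and J: "J = k + 1"
    using assms by (auto simp: k_def u_def)
  define S where "S = 2 * s"
  have S: "S = k + 2 + u" by (simp add: S_def k_def u_def)
  have pos: "J > 0" "S > 0" using assms by (auto simp: S_def)
  define a b c where "a = 3 * S + J + 1" and "b = 3 * S * (J + 1) + J\<^sup>2" and "c = S * (3 * S + 4 * J)"
  have abc: "a > 0" "b > 0" "c > 0"
    unfolding a_def b_def c_def using pos by (auto intro!: add_pos_pos mult_pos_pos)
  have "ln (1 + J / s) \<le> (J / s) * (6 + J / s) / (6 + 4 * (J / s))"
    using pos by (intro ln_one_plus_le_pade) (auto simp: S_def)
  also have "\<dots> = 2 * (J * (3 * S + J) / c)"
    using pos unfolding c_def S_def by (simp add: divide_simps add_pos_pos)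
  also have "\<dots> \<le> 2 * ((J + 1)\<^sup>2 / a - J ^ 3 / b)"
  proof -
    have "(J + 1)\<^sup>2 * b * c - J ^ 3 * a * c - J * (3 * S + J) * a * b =
      152 + 203*u + 81*u^2 + 9*u^3 + 364*k + 373*k*u + 90*k*u^2 + 372*k^2 + 297*k^2*u + 48*k^2*u^2
      + 200*k^3 + 119*k^3*u + 12*k^3*u^2 + 55*k^4 + 19*k^4*u + 6*k^5"
      unfolding a_def b_def c_def S J by (simp add: algebra_simps power_numeral_reduce)
    also have "\<dots> \<ge> 0" using ku by (intro add_nonneg_nonneg mult_nonneg_nonneg) auto
    finally have "J * (3 * S + J) * a * b \<le> (J + 1)\<^sup>2 * b * c - J ^ 3 * a * c" by simp
    then show ?thesis using abc by (simp add: field_simps)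
  qed
  also have "\<dots> = potential J s - potential (J - 1) (s + s / J)"
  proof -
    have "potential J s = 2 * ((J + 1)\<^sup>2 / a)" by (simp add: potential_def a_def S_def)
    moreover have "6 * (s + s / J) + (J - 1) + 1 = b / J"
      using pos by (simp add: b_def S_def field_simps power2_eq_square)
    then have "potential (J - 1) (s + s / J) = 2 * (J ^ 3 / b)"
      using pos abc by (simp add: potential_def field_simps power2_eq_square power3_eq_cube)
    ultimately show ?thesis by simp
  qed
  finally show ?thesis .
qed

text \<open>The endpoint \<open>x = 0\<close>, with the logarithm replaced by its tangent: for
  \<sigma> = \<open>s / J\<close>, the tangent to \<open>ln (1 + x)\<close> at \<sigma> takes the
  value \<open>ln (1 + \<sigma>) - \<sigma> / (1 + \<sigma>)\<close> at 0, and subtracting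
  \<open>ln \<sigma>\<close> gives the left side.\<close>

lemma ln_ratio_le_potential_diff_zero:
  fixes J s :: real
  assumes "J \<ge> 1" "s \<ge> (J + 1) / 2"
  shows "ln (1 + J / s) - s / (J + s) \<le> potential J s - potential (J - 1) s"
proof -
  define k u where "k = J - 1" and "u = 2 * s - J - 1"
  have ku: "k \<ge> 0" "u \<ge> 0" and J: "J = k + 1"
    using assms by (auto simp: k_def u_def)
  define S where "S = 2 * s"
  have S: "S = k + 2 + u" by (simp add: S_def k_def u_def)
  have pos: "J > 0" "S > 0" using assms by (auto simp: S_def)
  define a b c d where "a = 3 * S + J + 1" and "b = 3 * S + J" and "c = S * (3 * S + 4 * J)"
    and "d = 2 * (2 * J + S)"
  have abc: "a > 0" "b > 0" "c > 0" "d > 0"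
    unfolding a_def b_def c_def d_def using pos by (auto intro!: add_pos_pos mult_pos_pos)
  have "ln (1 + J / s) \<le> (J / s) * (6 + J / s) / (6 + 4 * (J / s))"
    using pos by (intro ln_one_plus_le_pade) (auto simp: S_def)
  also have "\<dots> = 2 * (J * (3 * S + J) / c)"
    using pos unfolding c_def S_def by (simp add: divide_simps add_pos_pos)
  also have "\<dots> \<le> 2 * ((J + 1)\<^sup>2 / a - J\<^sup>2 / b + S / d)"
  proof -
    have "(J + 1)\<^sup>2 * b * c * d - J\<^sup>2 * a * c * d + S * a * b * c - J * (3 * S + J) * a * b * d =
      2304 + 4864*u + 4014*u^2 + 1638*u^3 + 333*u^4 + 27*u^5
      + 5648*k + 9722*k*u + 6078*k*u^2 + 1665*k*u^3 + 171*k*u^4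
      + 5272*k^2 + 6996*k^2*u + 2949*k^2*u^2 + 405*k^2*u^3
      + 2280*k^3 + 2113*k^3*u + 453*k^3*u^2 + 428*k^4 + 218*k^4*u + 22*k^5"
      unfolding a_def b_def c_def d_def S J by (simp add: algebra_simps power_numeral_reduce)
    also have "\<dots> \<ge> 0" using ku by (intro add_nonneg_nonneg mult_nonneg_nonneg) auto
    finally have "J * (3 * S + J) * a * b * d
        \<le> (J + 1)\<^sup>2 * b * c * d - J\<^sup>2 * a * c * d + S * a * b * c" by simp
    then show ?thesis using abc by (simp add: field_simps)
  qed
  also have "\<dots> = potential J s - potential (J - 1) s + s / (J + s)"
    using pos by (simp add: potential_def a_def b_def d_def S_def field_simps)
  finally show ?thesis by simp
qed

text \<open>
  For \<open>x \<ge> s / J\<close> the left side decreases and the right side increases in \<open>x\<close>. On \<open>[0, s / J]\<close> the left side lies below its tangent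
  at \<open>s / J\<close> and the right side is concave, so the endpoints suffice: these are the two lemmas above.
\<close>

lemma ln_one_plus_le_potential:
  fixes J s x :: real
  assumes "J \<ge> 1" "s \<ge> (J + 1) / 2" "x \<ge> 0"
  shows "ln (1 + x) - ln (max x (s / J)) \<le> potential J s - potential (J - 1) (s + x)"
proof -
  define \<sigma> where "\<sigma> = s / J"
  have pos: "J > 0" "s > 0" "\<sigma> > 0" using assms by (auto simp: \<sigma>_def)
  have inv: "1 / \<sigma> = J / s" by (simp add: \<sigma>_def)
  have lnq: "ln (1 + y) - ln y = ln (1 + 1 / y)" if "y > 0" for y :: real
  proof -
    have "1 + 1 / y = (1 + y) / y" using that by (simp add: field_simps)
    then show ?thesis using that by (simp add: ln_div)
  qed
  show ?thesis
  proof (cases "x \<ge> \<sigma>")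
    case True
    have "ln (1 + x) - ln (max x (s / J)) = ln (1 + 1 / x)"
      using True pos by (simp add: \<sigma>_def[symmetric] max_def lnq)
    also have "\<dots> \<le> ln (1 + 1 / \<sigma>)"
      using True pos by (subst ln_le_cancel_iff) (auto intro!: add_pos_pos frac_le)
    also have "\<dots> \<le> potential J s - potential (J - 1) (s + \<sigma>)"
      unfolding inv using ln_ratio_le_potential_diff_max[OF assms(1,2)] by (simp add: \<sigma>_def)
    also have "\<dots> \<le> potential J s - potential (J - 1) (s + x)"
      using True pos by (auto simp: potential_def intro!: divide_left_mono mult_pos_pos add_pos_pos)
    finally show ?thesis .
  next
    case False
    define \<theta> where "\<theta> = x / \<sigma>"
    have \<theta>: "0 \<le> \<theta>" "\<theta> \<le> 1" and x: "x = \<theta> * \<sigma>"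
      using False pos assms by (auto simp: \<theta>_def field_simps)
    \<comment> \<open>The tangent bound at \<sigma>, which is affine in \<theta>; its endpoint
      values are those of the two preceding lemmas.\<close>
    have "ln (1 + x) - ln (1 + \<sigma>) \<le> (1 + x) / (1 + \<sigma>) - 1"
      using pos assms ln_le_minus_one[of "(1 + x) / (1 + \<sigma>)"] by (simp add: ln_div)
    also have "\<dots> = - ((1 - \<theta>) * (\<sigma> / (1 + \<sigma>)))"
      using pos by (simp add: x field_simps)
    also have "\<sigma> / (1 + \<sigma>) = s / (J + s)" using pos by (simp add: \<sigma>_def field_simps)
    finally have "ln (1 + x) - ln \<sigma> \<le> ln (1 + J / s) - (1 - \<theta>) * (s / (J + s))"
      using lnq[of \<sigma>] pos inv by simp
    also have "\<dots> = (1 - \<theta>) * (ln (1 + J / s) - s / (J + s)) + \<theta> * ln (1 + J / s)"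
      by (simp add: algebra_simps)
    also have "\<dots> \<le> (1 - \<theta>) * (potential J s - potential (J - 1) s)
        + \<theta> * (potential J s - potential (J - 1) (s + \<sigma>))"
      using \<theta> ln_ratio_le_potential_diff_max[OF assms(1,2)]
        ln_ratio_le_potential_diff_zero[OF assms(1,2)]
      unfolding \<sigma>_def by (intro add_mono mult_left_mono) auto
    also have "\<dots> = potential J s - 2 * J\<^sup>2 * ((1 - \<theta>) * (1 / (6 * s + J))
        + \<theta> * (1 / (6 * s + J + 6 * \<sigma>)))"
    proof -
      have "potential (J - 1) y = 2 * J\<^sup>2 * (1 / (6 * y + J))" for y
        by (simp add: potential_def)
      then show ?thesis by (simp add: algebra_simps)
    qed
    \<comment> \<open>Concavity of the right side: the potential is a positive multiple of the
      reciprocal of an affine function of \<theta>.\<close>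
    also have "\<dots> \<le> potential J s - 2 * J\<^sup>2 * (1 / (6 * s + J + \<theta> * (6 * \<sigma>)))"
      using pos \<theta> by (intro diff_left_mono mult_left_mono inverse_affine_convex) auto
    also have "\<dots> = potential J s - potential (J - 1) (s + x)"
      by (simp add: potential_def x algebra_simps)
    finally show ?thesis using False by (simp add: \<sigma>_def[symmetric] max_def)
  qed
qed

section \<open>Products and elementary symmetric sums\<close>

text \<open>The one-step inequalities multiply and the potential differences telescope. The
  application has \<open>x J = t * \<Upsilon> J\<close> and \<open>s J = t * T J\<close>.\<close>

lemma prod_one_plus_le_potential:
  fixes x s :: "nat \<Rightarrow> real"
  assumes "\<And>J. J \<in> {1..l} \<Longrightarrow> x J \<ge> 0"
    and "\<And>J. J \<in> {1..l} \<Longrightarrow> s (J - 1) = s J + x J"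
    and "\<And>J. J \<le> l \<Longrightarrow> s J \<ge> (real J + 1) / 2"
  shows "(\<Prod>J=1..l. 1 + x J) \<le> (\<Prod>J=1..l. max (x J) (s J / real J)) * exp (potential (real l) (s l))"
  using assms
proof (induction l)
  case 0
  \<comment> \<open>The initial potential is nonnegative, so it may be dropped.\<close>
  then have "s 0 \<ge> 1 / 2" by force
  then show ?case by (simp add: potential_def)
next
  case (Suc n)
  let ?x = "x (Suc n)" and ?s = "s (Suc n)"
  let ?m = "max ?x (?s / real (Suc n))"
  have x0: "?x \<ge> 0" and rec: "s n = ?s + ?x" and s: "?s \<ge> (real (Suc n) + 1) / 2"
    using Suc.prems(1)[of "Suc n"] Suc.prems(2)[of "Suc n"] Suc.prems(3)[of "Suc n"] by auto
  have m: "?m > 0" using s by (intro max.strict_coboundedI2 divide_pos_pos) auto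
  have IH: "(\<Prod>J=1..n. 1 + x J) \<le> (\<Prod>J=1..n. max (x J) (s J / real J)) * exp (potential (real n) (s n))"
    using Suc.prems by (intro Suc.IH) auto
  have "ln (1 + ?x) \<le> ln ?m + (potential (real (Suc n)) ?s - potential (real n) (s n))"
    using ln_one_plus_le_potential[of "real (Suc n)" ?s ?x] s x0 rec by simp
  then have "exp (ln (1 + ?x)) \<le> exp (ln ?m + (potential (real (Suc n)) ?s - potential (real n) (s n)))"
    by (simp only: exp_le_cancel_iff)
  then have step: "1 + ?x \<le> ?m * exp (potential (real (Suc n)) ?s - potential (real n) (s n))"
    using m x0 by (simp only: exp_add exp_ln)
  have "(\<Prod>J=1..Suc n. 1 + x J) = (\<Prod>J=1..n. 1 + x J) * (1 + ?x)"
    by simp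
  also have "\<dots> \<le> ((\<Prod>J=1..n. max (x J) (s J / real J)) * exp (potential (real n) (s n)))
      * (?m * exp (potential (real (Suc n)) ?s - potential (real n) (s n)))"
  proof (intro mult_mono IH step mult_nonneg_nonneg prod_nonneg)
    fix J assume "J \<in> {1..n}"
    then show "0 \<le> max (x J) (s J / real J)" using Suc.prems(1)[of J] by auto
  qed (use x0 in auto)
  also have "\<dots> = (\<Prod>J=1..Suc n. max (x J) (s J / real J)) * exp (potential (real (Suc n)) ?s)"
    by (simp add: exp_diff)
  finally show ?case .
qed

lemma sum_prod_le_prod_one_plus:
  fixes f :: "'a \<Rightarrow> real"
  assumes "finite A" "F \<subseteq> Pow A" "\<And>a. a \<in> A \<Longrightarrow> f a \<ge> 0"
  shows "(\<Sum>v\<in>F. \<Prod>a\<in>v. f a) \<le> (\<Prod>a\<in>A. 1 + f a)"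
proof -
  have "(\<Sum>v\<in>F. \<Prod>a\<in>v. f a) \<le> (\<Sum>v\<in>Pow A. \<Prod>a\<in>v. f a)"
    using assms by (intro sum_mono2) (auto intro!: prod_nonneg)
  also have "\<dots> = (\<Prod>a\<in>A. f a + 1)"
    by (simp add: prod_add[OF assms(1)])
  finally show ?thesis by (simp add: add.commute)
qed

lemma elementary_symmetric_le:
  fixes \<Upsilon> :: "nat \<Rightarrow> real"
  assumes nonneg: "\<And>j. j \<ge> 1 \<Longrightarrow> \<Upsilon> j \<ge> 0"
    and summable: "\<Upsilon> summable_on {1..}"
    and "finite F" and F: "\<And>v. v \<in> F \<Longrightarrow> finite v \<and> v \<subseteq> {1..} \<and> card v = l"
  shows "(\<Sum>v\<in>F. \<Prod>j\<in>v. \<Upsilon> j) \<le> exp (real (l + 1)) *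
       (\<Prod>J=1..l. max (\<Upsilon> J) (1 / real J * (\<Sum>\<^sub>\<infinity>j\<in>{J+1..}. \<Upsilon> j)))"
    (is "_ \<le> _ * (\<Prod>J=1..l. ?M J)")
proof -
  define T where "T J = (\<Sum>\<^sub>\<infinity>j\<in>{J+1..}. \<Upsilon> j)" for J :: nat
  have summ: "\<Upsilon> summable_on {J+1..}" for J
    using summable by (rule summable_on_subset) auto
  have T_nonneg: "T J \<ge> 0" for J
    unfolding T_def using nonneg by (intro infsum_nonneg) auto
  have T_rec: "T (J - 1) = T J + \<Upsilon> J" if "J \<ge> 1" for J
  proof -
    have "{J - 1 + 1..} = insert J {J+1..}" using that by auto
    then show ?thesis unfolding T_def using summ by (simp add: infsum_insert)
  qed
  have T_anti: "T l \<le> T J" if "J \<le> l" for J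
    unfolding T_def using that nonneg by (intro infsum_mono2 summ) auto
  have sum_le_T: "sum \<Upsilon> A \<le> T l" if "finite A" "A \<subseteq> {l+1..}" for A
    unfolding T_def using that nonneg by (intro finite_sum_le_infsum summ) auto
  have M_ge: "?M J \<ge> \<Upsilon> J" for J by simp
  have M_nonneg: "?M J \<ge> 0" if "J \<in> {1..l}" for J
    using nonneg[of J] that by (intro order_trans[OF _ M_ge]) auto
  show ?thesis
  proof (cases "T l = 0")
    \<comment> \<open>No \<open>t\<close> satisfies \<open>t * T l = (l + 1) / 2\<close> here. But
      all \<open>\<Upsilon> j\<close> with \<open>j > l\<close> vanish, so among sets of size
      \<open>l\<close> only \<open>{1..l}\<close> can contribute, and the bound holds with constant
      1.\<close>
    case True
    have zero: "\<Upsilon> j = 0" if "j > l" for j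
      using sum_le_T[of "{j}"] nonneg[of j] that True by auto
    have "(\<Sum>v\<in>F. \<Prod>j\<in>v. \<Upsilon> j) \<le> (\<Sum>v\<in>F. if v = {1..l} then (\<Prod>J=1..l. ?M J) else 0)"
    proof (rule sum_mono)
      fix v assume v: "v \<in> F"
      show "(\<Prod>j\<in>v. \<Upsilon> j) \<le> (if v = {1..l} then (\<Prod>J=1..l. ?M J) else 0)"
      proof (cases "v \<subseteq> {1..l}")
        case True
        then have "v = {1..l}" using F[OF v] by (intro card_subset_eq) auto
        then show ?thesis using nonneg M_ge by (auto intro!: prod_mono)
      next
        case False
        then obtain j where "j \<in> v" "j > l" using F[OF v] by (force simp: subset_iff)
        then have "(\<Prod>j\<in>v. \<Upsilon> j) = 0" using zero F[OF v] by (intro prod_zero) auto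
        then show ?thesis using False M_nonneg by (auto intro!: prod_nonneg)
      qed
    qed
    also have "\<dots> \<le> 1 * (\<Prod>J=1..l. ?M J)"
      using \<open>finite F\<close> prod_nonneg[of "{1..l}" ?M, OF M_nonneg]
      by (simp only: sum.delta) auto
    also have "\<dots> \<le> exp (real (l + 1)) * (\<Prod>J=1..l. ?M J)"
      using M_nonneg by (intro mult_right_mono prod_nonneg) auto
    finally show ?thesis .
  next
    case False
    then have Tpos: "T l > 0" using T_nonneg[of l] by simp
    \<comment> \<open>Since \<open>T J \<ge> T l\<close> for \<open>J \<le> l\<close>, this gives
      \<open>t * T J \<ge> (J + 1) / 2\<close>, as the product bound requires. Moreover
      \<open>potential l (t * T l)\<close> then equals \<open>(l + 1) / 2\<close>, the same as the
      exponent \<open>t * T l\<close> of the tail factors; together they give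
      \<open>l + 1\<close>.\<close>
    define t where "t = (real l + 1) / 2 / T l"
    have t: "t > 0" "t * T l = (real l + 1) / 2" using Tpos by (auto simp: t_def)
    \<comment> \<open>Inserting \<open>l\<close> ensures \<open>N \<ge> l\<close> and keeps the
      maximum meaningful when the union is empty.\<close>
    define N where "N = Max (insert l (\<Union>F))"
    have finU: "finite (insert l (\<Union>F))" using \<open>finite F\<close> F by auto
    have "l \<le> N" and FN: "F \<subseteq> Pow {1..N}"
      unfolding N_def using F Max_ge[OF finU] by (auto simp: subset_iff) 
    have "t ^ l * (\<Sum>v\<in>F. \<Prod>j\<in>v. \<Upsilon> j) = (\<Sum>v\<in>F. \<Prod>j\<in>v. t * \<Upsilon> j)"
      using F by (simp add: sum_distrib_left prod.distrib)
    also have "\<dots> \<le> (\<Prod>j=1..N. 1 + t * \<Upsilon> j)"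
      using FN nonneg t by (intro sum_prod_le_prod_one_plus) auto
    also have "{1..N} = {1..l} \<union> {l+1..N}" using \<open>l \<le> N\<close> by auto
    also have "(\<Prod>j\<in>\<dots>. 1 + t * \<Upsilon> j) = (\<Prod>j=1..l. 1 + t * \<Upsilon> j) * (\<Prod>j=l+1..N. 1 + t * \<Upsilon> j)"
      by (rule prod.union_disjoint) auto
    also have "\<dots> \<le> ((\<Prod>J=1..l. max (t * \<Upsilon> J) (t * T J / real J)) * exp ((real l + 1) / 2))
        * exp ((real l + 1) / 2)"
    proof (intro mult_mono)
      have "(\<Prod>j=1..l. 1 + t * \<Upsilon> j) \<le> (\<Prod>J=1..l. max (t * \<Upsilon> J) (t * T J / real J))
          * exp (potential (real l) (t * T l))"
      proof (rule prod_one_plus_le_potential)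
        fix J assume "J \<in> {1..l}"
        then show "0 \<le> t * \<Upsilon> J" "t * T (J - 1) = t * T J + t * \<Upsilon> J"
          using nonneg[of J] t T_rec[of J] by (auto simp: algebra_simps)
      next
        fix J assume "J \<le> l"
        then have "(real J + 1) / 2 \<le> t * T l" using t by simp
        also have "\<dots> \<le> t * T J" using t T_anti[OF \<open>J \<le> l\<close>] by simp
        finally show "(real J + 1) / 2 \<le> t * T J" .
      qed
      also have "potential (real l) (t * T l) = (real l + 1) / 2"
        unfolding t potential_def by (simp add: field_simps power2_eq_square)
      finally show "(\<Prod>j=1..l. 1 + t * \<Upsilon> j) \<le> (\<Prod>J=1..l. max (t * \<Upsilon> J) (t * T J / real J))
          * exp ((real l + 1) / 2)" .
      have "(\<Prod>j=l+1..N. 1 + t * \<Upsilon> j) \<le> (\<Prod>j=l+1..N. exp (t * \<Upsilon> j))"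
        using nonneg t by (intro prod_mono) auto
      also have "\<dots> = exp (t * sum \<Upsilon> {l+1..N})"
        by (simp add: exp_sum sum_distrib_left)
      also have "\<dots> \<le> exp (t * T l)"
        using t sum_le_T[of "{l+1..N}"] by auto
      finally show "(\<Prod>j=l+1..N. 1 + t * \<Upsilon> j) \<le> exp ((real l + 1) / 2)"
        using t by simp
    qed (use nonneg t in \<open>auto intro!: prod_nonneg mult_nonneg_nonneg simp: le_max_iff_disj\<close>)
    also have "\<dots> = exp (real (l + 1)) * (\<Prod>J=1..l. t * ?M J)"
    proof -
      have "max (t * \<Upsilon> J) (t * T J / real J) = t * ?M J" for J
        using t by (simp add: T_def max_mult_distrib_left)
      moreover have "exp ((real l + 1) / 2) * exp ((real l + 1) / 2) = exp (real (l + 1))"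
        by (simp add: exp_add[symmetric])
      ultimately show ?thesis by (simp add: mult.assoc mult.commute)
    qed
    \<comment> \<open>Both sides are homogeneous of degree \<open>l\<close>, so the scaling by
      \<open>t\<close> cancels.\<close>
    also have "\<dots> = t ^ l * (exp (real (l + 1)) * (\<Prod>J=1..l. ?M J))"
      by (simp add: prod.distrib)
    finally show ?thesis using t by simp
  qed
qed

section \<open>Summation over all finite sets\<close>

theorem theorem1:
  fixes \<Gamma> \<Upsilon> :: "nat \<Rightarrow> real" and m :: real
  assumes "\<And>l. \<Gamma> l \<ge> 0"
    and "\<And>j. j \<ge> 1 \<Longrightarrow> \<Upsilon> j \<ge> 0"
    and "\<Upsilon> summable_on {1..}"
    and "m > 0"
  shows "weight_sum (pod_weight \<Gamma> \<Upsilon>) m \<le>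
    ennreal (\<Gamma> 0) +
    (\<Sum>\<^sub>\<infinity>l\<in>{1..}. ennreal (exp (real (l + 1)) * \<Gamma> l * m ^ l *
       (\<Prod>J=1..l. max (\<Upsilon> J) (1 / real J * (\<Sum>\<^sub>\<infinity>j\<in>{J+1..}. \<Upsilon> j)))))"
  unfolding weight_sum_def
proof (rule infsum_le_finite_sums)
  let ?w = "\<lambda>v. ennreal (pod_weight \<Gamma> \<Upsilon> v * m ^ card v)"
  let ?R = "\<lambda>l. ennreal (exp (real (l + 1)) * \<Gamma> l * m ^ l *
       (\<Prod>J=1..l. max (\<Upsilon> J) (1 / real J * (\<Sum>\<^sub>\<infinity>j\<in>{J+1..}. \<Upsilon> j))))"
  show "?w summable_on {v. finite v \<and> v \<subseteq> {1..}}"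
    by (rule nonneg_summable_on_complete) simp
  fix F :: "nat set set" assume fin: "finite F" and F: "F \<subseteq> {v. finite v \<and> v \<subseteq> {1..}}"
  \<comment> \<open>It suffices to bound finite partial sums; each is grouped by
    cardinality.\<close>
  define G where "G l = {v \<in> F. card v = l}" for l
  have prod_nn: "(\<Prod>j\<in>v. \<Upsilon> j) \<ge> 0" if "v \<in> F" for v
    using F that assms(2) by (intro prod_nonneg) auto
  have G_le: "sum ?w (G l) \<le> ?R l" for l
  proof -
    have "sum ?w (G l) = ennreal (\<Sum>v\<in>G l. \<Gamma> l * m ^ l * (\<Prod>j\<in>v. \<Upsilon> j))"
      using assms prod_nn
      by (subst sum_ennreal[symmetric]) (auto simp: G_def pod_weight_def mult_ac intro!: sum.cong)
    also have "\<dots> = ennreal (\<Gamma> l * m ^ l * (\<Sum>v\<in>G l. \<Prod>j\<in>v. \<Upsilon> j))"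
      by (simp add: sum_distrib_left)
    also have "\<dots> \<le> ennreal (\<Gamma> l * m ^ l * (exp (real (l + 1)) *
        (\<Prod>J=1..l. max (\<Upsilon> J) (1 / real J * (\<Sum>\<^sub>\<infinity>j\<in>{J+1..}. \<Upsilon> j)))))"
      using assms fin F
      by (intro ennreal_leI mult_left_mono elementary_symmetric_le) (auto simp: G_def)
    finally show ?thesis by (simp add: mult_ac)
  qed
  \<comment> \<open>The general bound would cost a factor \<open>exp 1\<close> at
    \<open>l = 0\<close>. The constant 1 is available because only the empty set has cardinality 0
    here.\<close>
  have G0: "sum ?w (G 0) \<le> ennreal (\<Gamma> 0)"
  proof -
    have "sum ?w (G 0) \<le> sum ?w {{}}"
      using F by (intro sum_mono2) (auto simp: G_def)
    then show ?thesis by (simp add: pod_weight_def)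
  qed
  \<comment> \<open>Inserting 0 lets the term \<open>l = 0\<close> be split off even when the empty
    set is not in \<open>F\<close>.\<close>
  define L where "L = insert 0 (card ` F)"
  have L: "finite L" using fin by (simp add: L_def)
  have "sum ?w F = (\<Sum>l\<in>L. sum ?w (G l))"
    unfolding G_def using fin L by (intro sum.group[symmetric]) (auto simp: L_def)
  also have "\<dots> = sum ?w (G 0) + (\<Sum>l\<in>L - {0}. sum ?w (G l))"
    using L by (intro sum.remove) (auto simp: L_def)
  also have "\<dots> \<le> ennreal (\<Gamma> 0) + sum ?R (L - {0})"
    by (intro add_mono sum_mono G0 G_le)
  also have "sum ?R (L - {0}) \<le> infsum ?R {1..}"
    using L by (subst infsum_finite[symmetric], simp)
      (intro infsum_mono_neutral nonneg_summable_on_complete, auto)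
  finally show "sum ?w F \<le> ennreal (\<Gamma> 0) + infsum ?R {1..}"
    by (simp add: add_left_mono)
qed

end
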